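(* There exists a universal constant $c\in(0,\infty)$ with the following property. Fix $p,q,r,s\in[1,\infty)$ with $p\in[1,2)$ and $q\in(p,\infty)$. For arbitrarily large $n\in\mathbb N$ there exist $x_1,\ldots,x_n\in\ell_p$ such that for every $y_1,\ldots,y_n\in\ell_q$ with $$\left(\frac1{n^2}\sum_{i=1}^n\sum_{j=1}^n\|y_i-y_j\|_{\ell_q}^r\right)^{1/r}=\left(\frac1{n^2}\sum_{i=1}^n\sum_{j=1}^n\|x_i-x_j\|_{\ell_p}^s\right)^{1/s},$$ there exist $i,j\in\{1,\ldots,n\}$ such that $$\|y_i-y_j\|_{\ell_q}\ \ge\ c\,\frac{(\log n)^{\frac1p-\frac1{\min\{q,2\}}}}{\sqrt{q+r}}\,\|x_i-x_j\|_{\ell_p}>0 .$$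
   Context: $\ell_p$ is the usual Banach space of $p$-summable sequences. *)

theory Defs
  imports Complex_Main
begin

text \<open>Real scalars, coordinates indexed by \<^typ>\<open>nat\<close>. The norm is meaningful only on
  \<open>lp_space p\<close> (elsewhere \<open>suminf\<close> is unspecified). Since \<open>0 powr a = 0\<close>, zero coordinates
  contribute nothing and the zero sequence has norm \<open>0\<close>.\<close>

definition lp_space :: "real \<Rightarrow> (nat \<Rightarrow> real) set" where
  "lp_space p = {x. summable (\<lambda>k. \<bar>x k\<bar> powr p)}"

definition lp_norm :: "real \<Rightarrow> (nat \<Rightarrow> real) \<Rightarrow> real" where
  "lp_norm p x = (\<Sum>k. \<bar>x k\<bar> powr p) powr (1 / p)"

text \<open>\<open>avg_dist p s n x\<close> is the \<open>s\<close>-mean of the \<open>lp\<close>-distances over all \<open>n\<^sup>2\<close> ordered pairs of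
  indices; \<open>x i - x j\<close> is the pointwise difference of sequences.\<close>

definition avg_dist :: "real \<Rightarrow> real \<Rightarrow> nat \<Rightarrow> (nat \<Rightarrow> nat \<Rightarrow> real) \<Rightarrow> real" where
  "avg_dist p s n x =
     (1 / (real n)\<^sup>2 * (\<Sum>i=1..n. \<Sum>j=1..n. lp_norm p (x i - x j) powr s)) powr (1 / s)"

end

theory Submission
  imports Defs "HOL-Analysis.Convex" "HOL-Library.Indicator_Function"
begin

text \<open>Take \<open>n = 2\<^sup>d\<close> and let the \<open>x\<^sub>i\<close> be the vertices of the cube \<open>{0,1}\<^sup>d\<close>, encoded as the subsets
  of a \<open>d\<close>-element set. Their mean distance in \<open>\<ell>\<^sub>p\<close> is of order \<open>d powr (1/p)\<close>, while edges have length
  \<open>1\<close>. Conversely, if a map from the cube to \<open>\<ell>\<^sub>q\<close> stretches edges by at most \<open>L\<close>, then the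
  \<open>r\<close>-mean of its distances is at most of order \<open>sqrt (q + r) * d powr (1 / min q 2) * L\<close>: for the
  \<open>q\<close>-mean this is a scalar Poincare inequality summed over coordinates (type \<open>min q 2\<close> of
  \<open>\<ell>\<^sub>q\<close>), and higher means follow from concentration of Lipschitz functions on the cube. Both
  tensorise from an inequality on two points. Comparing the means, some edge is stretched enough.\<close>

subsection \<open>Two-point inequalities\<close>

text \<open>Convexity on positive arguments extends to the boundary: if \<open>a\<close> or
  \<open>b\<close> vanishes, the claim reduces to \<open>u powr p \<le> u\<close> for
  \<open>u\<close> in the unit interval.\<close>

lemma powr_convex_nonneg:
  fixes a b t p :: real
  assumes "p \<ge> 1" "0 \<le> t" "t \<le> 1" "0 \<le> a" "0 \<le> b"
  shows "((1 - t) * a + t * b) powr p \<le> (1 - t) * a powr p + t * b powr p"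
proof -
  have zero: "(u * v) powr p \<le> u * v powr p" if "0 \<le> u" "u \<le> 1" "0 \<le> v" for u v :: real
    using that powr_mono'[of 1 p u] assms(1) by (simp add: powr_mult mult_right_mono)
  consider "a = 0" | "b = 0" | "a > 0" "b > 0"
    using assms by linarith
  then show ?thesis
  proof cases
    case 1 then show ?thesis using zero[of t b] assms by simp
  next
    case 2 then show ?thesis using zero[of "1 - t" a] assms by simp
  next
    case 3 then show ?thesis
      using convex_onD[OF powr_convex[OF assms(1)] assms(2,3), of a b] by simp
  qed
qed

lemma powr_midpoint:
  fixes a b p :: real
  assumes "p \<ge> 1" "0 \<le> a" "0 \<le> b"
  shows "((a + b) / 2) powr p \<le> (a powr p + b powr p) / 2"
  using powr_convex_nonneg[of p "1/2" a b] assms by (simp add: field_simps)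

text \<open>Convexity with the exponent \<open>1 / h\<close>, applied to \<open>a powr h\<close> and
  \<open>b powr h\<close>, then raised to the power \<open>h\<close>.\<close>

lemma powr_midpoint_concave:
  fixes a b h :: real
  assumes "0 < h" "h \<le> 1" "0 \<le> a" "0 \<le> b"
  shows "(a powr h + b powr h) / 2 \<le> ((a + b) / 2) powr h"
proof -
  have "((a powr h + b powr h) / 2) powr (1 / h) \<le> (a + b) / 2"
    using powr_midpoint[of "1/h" "a powr h" "b powr h"] assms by (simp add: powr_powr)
  then have "(((a powr h + b powr h) / 2) powr (1 / h)) powr h \<le> ((a + b) / 2) powr h"
    using assms by (intro powr_mono2) auto
  then show ?thesis using assms by (simp add: powr_powr)
qed

text \<open>After scaling to \<open>a + b = 1\<close>, both fractions lie in the unit interval,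
  where \<open>u \<le> u powr h\<close>.\<close>

lemma powr_add_subadditive:
  fixes a b h :: real
  assumes "0 < h" "h \<le> 1" "0 \<le> a" "0 \<le> b"
  shows "(a + b) powr h \<le> a powr h + b powr h"
proof (cases "a + b = 0")
  case False
  then have pos: "a + b > 0" using assms by simp
  define u where "u = a / (a + b)"
  have u: "0 \<le> u" "u \<le> 1" "1 - u = b / (a + b)"
    using pos assms by (auto simp: u_def field_simps)
  have "u powr 1 \<le> u powr h" "(1 - u) powr 1 \<le> (1 - u) powr h"
    using u assms by (intro powr_mono'; simp)+
  then have "1 \<le> u powr h + (1 - u) powr h" using u(1,2) by simp
  also have "\<dots> = (a powr h + b powr h) / (a + b) powr h"
    using assms pos unfolding u(3) unfolding u_def by (simp add: powr_divide add_divide_distrib)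
  finally show ?thesis using pos by (simp add: field_simps)
qed (use assms in simp)

text \<open>Bernoulli's inequality for real exponents, from the weighted AM-GM inequality for
  \<open>1 + m * z\<close> and \<open>1\<close> with weights \<open>1 / m\<close> and
  \<open>1 - 1 / m\<close>.\<close>

lemma one_plus_mult_le_powr:
  fixes m z :: real
  assumes "m \<ge> 1" "z \<ge> 0"
  shows "1 + m * z \<le> (1 + z) powr m"
proof -
  have "(1 + m * z) powr (1 / m) * 1 powr (1 - 1 / m) \<le> 1 / m * (1 + m * z) + (1 - 1 / m) * 1"
    using assms by (intro Youngs_inequality_0) (auto intro!: add_pos_nonneg)
  also have "\<dots> = 1 + z" using assms by (simp add: field_simps)
  finally have "((1 + m * z) powr (1 / m)) powr m \<le> (1 + z) powr m"
    using assms by (intro powr_mono2) auto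
  then show ?thesis using assms by (simp add: powr_powr)
qed

lemma abs_powr_eq_square_powr: "\<bar>x\<bar> powr p = (x\<^sup>2) powr (p / 2)" for x p :: real
proof -
  have "\<bar>x\<bar> powr p = (\<bar>x\<bar> powr 2) powr (p / 2)" by (simp only: powr_powr) simp
  then show ?thesis by simp
qed

text \<open>Concavity of the power \<open>p / 2\<close> passes to squares, the parallelogram law
  evaluates them, and subadditivity separates the terms. Both constants are \<open>1\<close>, so
  tensorising costs nothing.\<close>

lemma two_point_le_two:
  fixes a b p :: real
  assumes "1 \<le> p" "p \<le> 2"
  shows "(\<bar>a + b\<bar> powr p + \<bar>a - b\<bar> powr p) / 2 \<le> \<bar>a\<bar> powr p + \<bar>b\<bar> powr p"
proof -
  have "(\<bar>a + b\<bar> powr p + \<bar>a - b\<bar> powr p) / 2 \<le> (((a + b)\<^sup>2 + (a - b)\<^sup>2) / 2) powr (p / 2)"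
    unfolding abs_powr_eq_square_powr using assms by (intro powr_midpoint_concave) auto
  also have "((a + b)\<^sup>2 + (a - b)\<^sup>2) / 2 = a\<^sup>2 + b\<^sup>2"
    by (simp add: power2_eq_square algebra_simps)
  also have "(a\<^sup>2 + b\<^sup>2) powr (p / 2) \<le> \<bar>a\<bar> powr p + \<bar>b\<bar> powr p"
    unfolding abs_powr_eq_square_powr using assms by (intro powr_add_subadditive) auto
  finally show ?thesis .
qed

text \<open>A non-sharp form of Bonami's two-point inequality, with \<open>3 * p\<close> in place of
  \<open>p - 1\<close>. For \<open>p * x \<le> 1\<close> a second-order expansion suffices;
  otherwise \<open>1 + x\<close> alone is already below the square root of
  \<open>1 + 3 * p * x\<^sup>2\<close>.\<close>

lemma two_point_normalised:
  fixes x p :: real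
  assumes p: "p \<ge> 2" and x: "x \<ge> 0"
  shows "((1 + x) powr p + \<bar>1 - x\<bar> powr p) / 2 \<le> (1 + 3 * p * x\<^sup>2) powr (p / 2)"
proof (cases "p * x \<le> 1")
  case True
  have x1: "x \<le> 1" using True p x mult_right_mono[of 1 p x] by linarith
  have powr_le: "(1 + z) powr p \<le> exp (p * z)" if "1 + z \<ge> 0" for z :: real
    using powr_mono2[of p "1 + z" "exp z"] that p by (simp add: exp_powr_real mult.commute)
  define u where "u = p * x"
  have u: "0 \<le> u" "u \<le> 1" using True p x by (auto simp: u_def)
  have "exp (- u) = 1 / exp u" by (simp add: exp_minus field_simps)
  also have "\<dots> \<le> 1 / (1 + u)" using u by (intro divide_left_mono) auto
  also have "\<dots> \<le> 1 - u + u\<^sup>2"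
  proof -
    have "(1 - u + u\<^sup>2) * (1 + u) = 1 + u ^ 3" by (simp add: eval_nat_numeral algebra_simps)
    then show ?thesis using u by (simp add: pos_divide_le_eq)
  qed
  finally have "exp (- u) \<le> 1 - u + u\<^sup>2" .
  moreover have "exp u \<le> 1 + u + u\<^sup>2" using u by (intro exp_bound) auto
  \<comment> \<open>The two powers are at most \<open>exp u\<close> and \<open>exp (- u)\<close>;
    the linear terms of their bounds cancel in the average.\<close>
  ultimately have "((1 + x) powr p + \<bar>1 - x\<bar> powr p) / 2 \<le> 1 + u\<^sup>2"
    using powr_le[of x] powr_le[of "- x"] x x1 by (simp add: u_def)
  also have "\<dots> \<le> 1 + p / 2 * (3 * p * x\<^sup>2)"
    using p x by (simp add: u_def power2_eq_square)
  also have "\<dots> \<le> (1 + 3 * p * x\<^sup>2) powr (p / 2)"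
    using p x by (intro one_plus_mult_le_powr) auto
  finally show ?thesis .
next
  case False
  \<comment> \<open>Source of the factor 3: in \<open>(1 + x)\<^sup>2\<close> the term
    \<open>2 * x\<close> costs two copies of \<open>p * x\<^sup>2\<close> and
    \<open>x\<^sup>2\<close> costs one.\<close>
  have "x * 1 \<le> x * (p * x)" using False x by (intro mult_left_mono) auto
  moreover have "x\<^sup>2 * 1 \<le> x\<^sup>2 * p" using p by (intro mult_left_mono) auto
  ultimately have "(1 + x)\<^sup>2 \<le> 1 + 3 * p * x\<^sup>2"
    by (simp add: power2_eq_square algebra_simps)
  then have "((1 + x)\<^sup>2) powr (p / 2) \<le> (1 + 3 * p * x\<^sup>2) powr (p / 2)"
    using p by (intro powr_mono2) auto
  then have "(1 + x) powr p \<le> (1 + 3 * p * x\<^sup>2) powr (p / 2)"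
    using abs_powr_eq_square_powr[of "1 + x" p] x by simp
  moreover have "\<bar>1 - x\<bar> powr p \<le> (1 + x) powr p" using x p by (intro powr_mono2) auto
  ultimately show ?thesis by simp
qed

text \<open>Homogeneity: dividing by \<open>\<bar>a\<bar>\<close> leaves the normalised inequality.
  Signs are irrelevant, since changing them only permutes the two terms on the left.\<close>

lemma two_point_ge_two:
  fixes a b p :: real
  assumes p: "p \<ge> 2"
  shows "(\<bar>a + b\<bar> powr p + \<bar>a - b\<bar> powr p) / 2 \<le> (a\<^sup>2 + 3 * p * b\<^sup>2) powr (p / 2)"
proof (cases "a = 0")
  case True
  have "b\<^sup>2 * 1 \<le> b\<^sup>2 * (3 * p)" using p by (intro mult_left_mono) auto
  then have "(b\<^sup>2) powr (p / 2) \<le> (3 * p * b\<^sup>2) powr (p / 2)"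
    using p by (intro powr_mono2) (auto simp: mult.commute)
  then show ?thesis using True by (simp add: abs_powr_eq_square_powr)
next
  case False
  define x where "x = \<bar>b\<bar> / \<bar>a\<bar>"
  have bx: "\<bar>b\<bar> = \<bar>a\<bar> * x" using False by (simp add: x_def)
  have x: "x \<ge> 0" by (simp add: x_def)
  have "\<bar>a + b\<bar> powr p + \<bar>a - b\<bar> powr p = (\<bar>a\<bar> + \<bar>b\<bar>) powr p + \<bar>\<bar>a\<bar> - \<bar>b\<bar>\<bar> powr p"
  proof -
    have "\<bar>a + b\<bar> = \<bar>a\<bar> + \<bar>b\<bar> \<and> \<bar>a - b\<bar> = \<bar>\<bar>a\<bar> - \<bar>b\<bar>\<bar> \<or>
        \<bar>a - b\<bar> = \<bar>a\<bar> + \<bar>b\<bar> \<and> \<bar>a + b\<bar> = \<bar>\<bar>a\<bar> - \<bar>b\<bar>\<bar>" by linarith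
    then show ?thesis by (elim disjE conjE) simp_all
  qed
  also have "\<dots> = \<bar>a\<bar> powr p * ((1 + x) powr p + \<bar>1 - x\<bar> powr p)"
  proof -
    have "\<bar>a\<bar> + \<bar>b\<bar> = \<bar>a\<bar> * (1 + x)" "\<bar>a\<bar> - \<bar>b\<bar> = \<bar>a\<bar> * (1 - x)"
      unfolding bx by (simp_all add: algebra_simps)
    then have "\<bar>a\<bar> + \<bar>b\<bar> = \<bar>a\<bar> * (1 + x)" "\<bar>\<bar>a\<bar> - \<bar>b\<bar>\<bar> = \<bar>a\<bar> * \<bar>1 - x\<bar>"
      by (simp_all add: abs_mult)
    then show ?thesis by (simp only: powr_mult flip: distrib_left)
  qed
  finally have "(\<bar>a + b\<bar> powr p + \<bar>a - b\<bar> powr p) / 2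
      = \<bar>a\<bar> powr p * (((1 + x) powr p + \<bar>1 - x\<bar> powr p) / 2)" by simp
  also have "\<dots> \<le> \<bar>a\<bar> powr p * (1 + 3 * p * x\<^sup>2) powr (p / 2)"
    using two_point_normalised[OF p x] by (intro mult_left_mono) auto
  also have "\<dots> = (a\<^sup>2 * (1 + 3 * p * x\<^sup>2)) powr (p / 2)"
    by (simp add: abs_powr_eq_square_powr powr_mult)
  also have "a\<^sup>2 * (1 + 3 * p * x\<^sup>2) = a\<^sup>2 + 3 * p * b\<^sup>2"
    using arg_cong[OF bx, of "\<lambda>z. z\<^sup>2"] by (simp add: power_mult_distrib algebra_simps)
  finally show ?thesis .
qed

text \<open>The weights \<open>(1 + 1/d)\<close> and \<open>d + 1\<close> are conjugate, so convexity separates the two summands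
  of \<open>two_point_ge_two\<close>; the \<open>d\<close>-th power of the first one stays bounded.\<close>

lemma two_point_ge_two_split:
  fixes a b p d :: real
  assumes p: "p \<ge> 2" and d: "d > 0"
  shows "(\<bar>a + b\<bar> powr p + \<bar>a - b\<bar> powr p) / 2
    \<le> (1 + 1 / d) powr (p / 2 - 1) * \<bar>a\<bar> powr p
      + (d + 1) powr (p / 2 - 1) * (3 * p) powr (p / 2) * \<bar>b\<bar> powr p"
proof -
  \<comment> \<open>Convex weights \<open>1 - t\<close> and \<open>t\<close> produce the factors
    \<open>1 / (1 - t)\<close> and \<open>1 / t\<close>, each to the power \<open>p / 2 - 1\<close>.
    In the applications \<open>d\<close> is the dimension of the cube.\<close>
  define t where "t = 1 / (d + 1)"
  have t: "0 < t" "t < 1" and inv: "1 / (1 - t) = 1 + 1 / d" "1 / t = d + 1"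
    using d by (auto simp: t_def field_simps)
  have split: "w * (X / w) powr (p / 2) = (1 / w) powr (p / 2 - 1) * X powr (p / 2)"
    if "w > 0" for w X :: real
    using that by (simp add: powr_divide powr_diff)
  have "(a\<^sup>2 + 3 * p * b\<^sup>2) powr (p / 2)
      = ((1 - t) * (a\<^sup>2 / (1 - t)) + t * (3 * p * b\<^sup>2 / t)) powr (p / 2)"
    using t by simp
  also have "\<dots> \<le> (1 - t) * (a\<^sup>2 / (1 - t)) powr (p / 2) + t * (3 * p * b\<^sup>2 / t) powr (p / 2)"
    using t p by (intro powr_convex_nonneg) auto
  also have "\<dots> = (1 + 1 / d) powr (p / 2 - 1) * (a\<^sup>2) powr (p / 2)
      + (d + 1) powr (p / 2 - 1) * (3 * p * b\<^sup>2) powr (p / 2)"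
    using t by (simp only: split inv diff_gt_0_iff_gt)
  finally show ?thesis using two_point_ge_two[OF p, of a b]
    unfolding abs_powr_eq_square_powr[of a p] abs_powr_eq_square_powr[of b p]
    by (simp add: powr_mult mult.assoc)
qed

subsection \<open>Poincare inequalities on the cube\<close>

text \<open>Expectation under the uniform measure on the cube. Vertices are subsets of
  \<open>A\<close>, so that induction on the finite set \<open>A\<close> adds one coordinate at a
  time.\<close>

definition cube_avg :: "nat set \<Rightarrow> (nat set \<Rightarrow> real) \<Rightarrow> real" where
  "cube_avg A g = (\<Sum>S\<in>Pow A. g S) / 2 ^ card A"

lemma cube_avg_empty [simp]: "cube_avg {} g = g {}"
  by (simp add: cube_avg_def)

lemma cube_avg_insert:
  assumes "finite A" "a \<notin> A"
  shows "cube_avg (insert a A) g = (cube_avg A g + cube_avg A (\<lambda>S. g (insert a S))) / 2"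
proof -
  have "(\<Sum>S\<in>Pow (insert a A). g S) = (\<Sum>S\<in>Pow A. g S) + (\<Sum>S\<in>insert a ` Pow A. g S)"
    unfolding Pow_insert using assms by (intro sum.union_disjoint) auto
  also have "(\<Sum>S\<in>insert a ` Pow A. g S) = (\<Sum>S\<in>Pow A. g (insert a S))"
    using assms by (intro sum.reindex_cong[of "insert a"]) (auto simp: inj_on_def)
  finally show ?thesis using assms by (simp add: cube_avg_def field_simps)
qed

lemma cube_avg_cong:
  "(\<And>S. S \<subseteq> A \<Longrightarrow> g S = h S) \<Longrightarrow> cube_avg A g = cube_avg A h"
  by (auto simp: cube_avg_def intro!: sum.cong arg_cong2[where f = "(/)"])

lemma cube_avg_mono:
  "(\<And>S. S \<subseteq> A \<Longrightarrow> g S \<le> h S) \<Longrightarrow> cube_avg A g \<le> cube_avg A h"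
  by (auto simp: cube_avg_def intro!: sum_mono divide_right_mono)

lemma cube_avg_nonneg: "(\<And>S. S \<subseteq> A \<Longrightarrow> 0 \<le> g S) \<Longrightarrow> 0 \<le> cube_avg A g"
  by (auto simp: cube_avg_def intro!: sum_nonneg divide_nonneg_pos)

lemma cube_avg_const [simp]: "finite A \<Longrightarrow> cube_avg A (\<lambda>S. c) = c"
  by (simp add: cube_avg_def card_Pow)

lemma cube_avg_add: "cube_avg A (\<lambda>S. g S + h S) = cube_avg A g + cube_avg A h"
  by (simp add: cube_avg_def sum.distrib add_divide_distrib)

lemma cube_avg_diff: "cube_avg A (\<lambda>S. g S - h S) = cube_avg A g - cube_avg A h"
  by (simp add: cube_avg_def sum_subtractf diff_divide_distrib)

lemma cube_avg_cmult: "cube_avg A (\<lambda>S. c * g S) = c * cube_avg A g"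
  by (simp add: cube_avg_def sum_distrib_left)

lemma cube_avg_sums:
  assumes "\<And>S. S \<subseteq> A \<Longrightarrow> (\<lambda>k. g S k) sums G S"
  shows "(\<lambda>k. cube_avg A (\<lambda>S. g S k)) sums cube_avg A G"
  unfolding cube_avg_def using assms by (intro sums_divide sums_sum) auto

text \<open>Jensen's inequality by induction on the coordinates, so that only midpoint convexity is
  used.\<close>

lemma cube_avg_jensen:
  assumes "finite A" and p: "p \<ge> 1"
  shows "\<bar>cube_avg A g\<bar> powr p \<le> cube_avg A (\<lambda>S. \<bar>g S\<bar> powr p)"
  using assms(1)
proof (induction A arbitrary: g rule: finite_induct)
  case (insert a A)
  let ?u = "cube_avg A g" and ?v = "cube_avg A (\<lambda>S. g (insert a S))"
  have "\<bar>(?u + ?v) / 2\<bar> powr p \<le> ((\<bar>?u\<bar> + \<bar>?v\<bar>) / 2) powr p"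
    using p by (intro powr_mono2) auto
  also have "\<dots> \<le> (\<bar>?u\<bar> powr p + \<bar>?v\<bar> powr p) / 2"
    using p by (intro powr_midpoint) auto
  also have "\<dots> \<le> (cube_avg A (\<lambda>S. \<bar>g S\<bar> powr p)
      + cube_avg A (\<lambda>S. \<bar>g (insert a S)\<bar> powr p)) / 2"
    by (intro divide_right_mono add_mono insert.IH) simp
  finally show ?case using insert.hyps by (simp add: cube_avg_insert)
qed simp

text \<open>\<open>insert k S\<close> and \<open>S - {k}\<close> are the two ends of the edge
  through \<open>S\<close> in direction \<open>k\<close>; the average runs over all vertices, so it
  meets each edge from both ends.\<close>

definition edge_energy :: "real \<Rightarrow> nat set \<Rightarrow> (nat set \<Rightarrow> real) \<Rightarrow> real" where
  "edge_energy p A g = (\<Sum>k\<in>A. cube_avg A (\<lambda>S. \<bar>g (insert k S) - g (S - {k})\<bar> powr p))"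

lemma edge_energy_nonneg: "0 \<le> edge_energy p A g"
  unfolding edge_energy_def by (intro sum_nonneg cube_avg_nonneg) auto

text \<open>Edges in the old directions lie in one of the two facets, without or with
  \<open>a\<close>; edges in direction \<open>a\<close> join the facets.\<close>

lemma edge_energy_insert:
  assumes A: "finite A" and a: "a \<notin> A"
  shows "edge_energy p (insert a A) g
    = (edge_energy p A g + edge_energy p A (\<lambda>S. g (insert a S))) / 2
      + cube_avg A (\<lambda>S. \<bar>g (insert a S) - g S\<bar> powr p)"
proof -
  have edges: "cube_avg (insert a A) (\<lambda>S. \<bar>g (insert k S) - g (S - {k})\<bar> powr p)
      = (cube_avg A (\<lambda>S. \<bar>g (insert k S) - g (S - {k})\<bar> powr p)
        + cube_avg A (\<lambda>S. \<bar>g (insert a (insert k S)) - g (insert a (S - {k}))\<bar> powr p)) / 2"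
    if "k \<in> A" for k
  proof -
    have "insert a S - {k} = insert a (S - {k})" for S using that a by auto
    then show ?thesis using A a by (simp add: cube_avg_insert insert_commute)
  qed
  have new_edges: "cube_avg (insert a A) (\<lambda>S. \<bar>g (insert a S) - g (S - {a})\<bar> powr p)
      = cube_avg A (\<lambda>S. \<bar>g (insert a S) - g S\<bar> powr p)"
  proof -
    have "S - {a} = S" if "S \<subseteq> A" for S using that a by auto
    then have "cube_avg A (\<lambda>S. \<bar>g (insert a S) - g (S - {a})\<bar> powr p)
        = cube_avg A (\<lambda>S. \<bar>g (insert a S) - g S\<bar> powr p)"
      by (intro cube_avg_cong) simp
    then show ?thesis using A a by (simp add: cube_avg_insert)
  qed
  have "edge_energy p (insert a A) g
      = (\<Sum>k\<in>A. cube_avg (insert a A) (\<lambda>S. \<bar>g (insert k S) - g (S - {k})\<bar> powr p))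
        + cube_avg A (\<lambda>S. \<bar>g (insert a S) - g S\<bar> powr p)"
    using A a new_edges by (simp add: edge_energy_def)
  also have "(\<Sum>k\<in>A. cube_avg (insert a A) (\<lambda>S. \<bar>g (insert k S) - g (S - {k})\<bar> powr p))
      = (edge_energy p A g + edge_energy p A (\<lambda>S. g (insert a S))) / 2"
    unfolding edge_energy_def sum.distrib[symmetric] sum_divide_distrib
    by (intro sum.cong refl edges)
  finally show ?thesis .
qed

text \<open>A two-point inequality tensorises: conditioning on one bit applies it to the conditional
  means, whose difference is an average of edge differences.\<close>

lemma cube_poincare:
  fixes p \<alpha> \<beta> c :: real
  assumes "finite A" and p: "p \<ge> 1" and \<alpha>: "\<alpha> \<ge> 1" and \<beta>: "\<beta> \<ge> 0"
    and two_point: "\<And>a b. (\<bar>a + b\<bar> powr p + \<bar>a - b\<bar> powr p) / 2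
      \<le> \<alpha> * \<bar>a\<bar> powr p + \<beta> * \<bar>b\<bar> powr p"
  shows "cube_avg A (\<lambda>S. \<bar>g S - c\<bar> powr p)
    \<le> \<alpha> ^ card A * (\<bar>cube_avg A g - c\<bar> powr p + \<beta> * edge_energy p A g)"
  using assms(1)
proof (induction A arbitrary: g rule: finite_induct)
  case empty
  then show ?case by (simp add: edge_energy_def)
next
  case (insert a A)
  let ?h = "\<lambda>S. g (insert a S)"
  let ?u = "cube_avg A g" and ?v = "cube_avg A ?h"
  let ?m = "(?v + ?u) / 2 - c" and ?b = "(?v - ?u) / 2"
  let ?D = "cube_avg A (\<lambda>S. \<bar>?h S - g S\<bar> powr p)"
  let ?E = "edge_energy p A g" and ?F = "edge_energy p A ?h"
  \<comment> \<open>Jensen bounds the difference of the conditional means by the energy in direction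
    \<open>a\<close>; the gain from halving it is discarded.\<close>
  have D: "\<bar>?b\<bar> powr p \<le> ?D"
  proof -
    have "\<bar>?b\<bar> powr p \<le> \<bar>cube_avg A (\<lambda>S. ?h S - g S)\<bar> powr p"
      unfolding cube_avg_diff using p by (intro powr_mono2) auto
    also have "\<dots> \<le> ?D" by (intro cube_avg_jensen insert.hyps p)
    finally show ?thesis .
  qed
  have shifts: "?m + ?b = ?v - c" "?m - ?b = ?u - c" by (simp_all add: field_simps)
  have "(\<bar>?u - c\<bar> powr p + \<bar>?v - c\<bar> powr p) / 2 \<le> \<alpha> * \<bar>?m\<bar> powr p + \<beta> * \<bar>?b\<bar> powr p"
    using two_point[of ?m ?b] unfolding shifts by (simp add: add.commute)
  also have "\<dots> \<le> \<alpha> * \<bar>?m\<bar> powr p + \<beta> * ?D"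
    using D \<beta> by (intro add_left_mono mult_left_mono) auto
  finally have "(\<bar>?u - c\<bar> powr p + \<bar>?v - c\<bar> powr p) / 2 + \<beta> * ((?E + ?F) / 2)
      \<le> \<alpha> * \<bar>?m\<bar> powr p + \<beta> * ((?E + ?F) / 2 + ?D)"
    by (simp add: distrib_left)
  \<comment> \<open>Since \<open>\<alpha> \<ge> 1\<close>, the energy may carry the factor
    \<open>\<alpha>\<close> too, which restores the shape of the claim with one more power of
    \<open>\<alpha>\<close>.\<close>
  also have "\<dots> \<le> \<alpha> * \<bar>?m\<bar> powr p + \<alpha> * (\<beta> * ((?E + ?F) / 2 + ?D))"
  proof -
    have "0 \<le> \<beta> * ((?E + ?F) / 2 + ?D)"
      using \<beta> by (intro mult_nonneg_nonneg add_nonneg_nonneg divide_nonneg_pos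
        edge_energy_nonneg cube_avg_nonneg) auto
    then show ?thesis using mult_right_mono[OF \<alpha>] by simp
  qed
  finally have step: "(\<bar>?u - c\<bar> powr p + \<bar>?v - c\<bar> powr p) / 2 + \<beta> * ((?E + ?F) / 2)
      \<le> \<alpha> * (\<bar>?m\<bar> powr p + \<beta> * ((?E + ?F) / 2 + ?D))" by (simp add: distrib_left)
  have "cube_avg (insert a A) (\<lambda>S. \<bar>g S - c\<bar> powr p)
      \<le> (\<alpha> ^ card A * (\<bar>?u - c\<bar> powr p + \<beta> * ?E)
        + \<alpha> ^ card A * (\<bar>?v - c\<bar> powr p + \<beta> * ?F)) / 2"
    unfolding cube_avg_insert[OF insert.hyps]
    by (intro divide_right_mono add_mono insert.IH) simp
  also have "\<dots> = \<alpha> ^ card A * ((\<bar>?u - c\<bar> powr p + \<bar>?v - c\<bar> powr p) / 2 + \<beta> * ((?E + ?F) / 2))"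
    by (simp add: field_simps)
  also have "\<dots> \<le> \<alpha> ^ card A * (\<alpha> * (\<bar>?m\<bar> powr p + \<beta> * ((?E + ?F) / 2 + ?D)))"
    using \<alpha> by (intro mult_left_mono step) auto
  also have "\<dots> = \<alpha> ^ card (insert a A) * (\<bar>cube_avg (insert a A) g - c\<bar> powr p
      + \<beta> * edge_energy p (insert a A) g)"
    using insert.hyps by (simp add: cube_avg_insert edge_energy_insert add.commute)
  finally show ?case .
qed

text \<open>\<open>cube_poincare\<close> is used twice: for fixed \<open>T\<close> with the centre
  \<open>g T\<close>, then with the mean of \<open>g\<close> as centre.\<close>

lemma cube_pairs_poincare:
  fixes p \<alpha> \<beta> :: real
  assumes "finite A" and p: "p \<ge> 1" and \<alpha>: "\<alpha> \<ge> 1" and \<beta>: "\<beta> \<ge> 0"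
    and two_point: "\<And>a b. (\<bar>a + b\<bar> powr p + \<bar>a - b\<bar> powr p) / 2
      \<le> \<alpha> * \<bar>a\<bar> powr p + \<beta> * \<bar>b\<bar> powr p"
  shows "cube_avg A (\<lambda>T. cube_avg A (\<lambda>S. \<bar>g S - g T\<bar> powr p))
    \<le> 2 * \<alpha> ^ card A * \<alpha> ^ card A * \<beta> * edge_energy p A g"
proof -
  let ?a = "\<alpha> ^ card A" and ?E = "edge_energy p A g"
  note P = cube_poincare[OF assms]
  have a1: "?a \<ge> 1" using \<alpha> by simp
  have E: "0 \<le> \<beta> * ?E" using \<beta> by (simp add: edge_energy_nonneg)
  have "cube_avg A (\<lambda>T. cube_avg A (\<lambda>S. \<bar>g S - g T\<bar> powr p))
      \<le> cube_avg A (\<lambda>T. ?a * (\<bar>g T - cube_avg A g\<bar> powr p + \<beta> * ?E))"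
    by (intro cube_avg_mono) (use P in \<open>simp add: abs_minus_commute\<close>)
  also have "\<dots> = ?a * (cube_avg A (\<lambda>T. \<bar>g T - cube_avg A g\<bar> powr p) + \<beta> * ?E)"
    using assms(1) by (simp only: cube_avg_cmult cube_avg_add cube_avg_const)
  also have "\<dots> \<le> ?a * (?a * (\<beta> * ?E) + \<beta> * ?E)"
    using P[of g "cube_avg A g"] a1 by (intro mult_left_mono add_right_mono) auto
  also have "\<dots> \<le> ?a * (?a * (\<beta> * ?E) + ?a * (\<beta> * ?E))"
    using a1 mult_right_mono[OF a1 E] by (intro mult_left_mono add_left_mono) auto
  also have "\<dots> = 2 * ?a * ?a * \<beta> * ?E" by simp
  finally show ?thesis .
qed

subsection \<open>The norm of the sequence spaces\<close>

lemma lp_norm_nonneg: "0 \<le> lp_norm p x"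
  by (simp add: lp_norm_def)

lemma lp_norm_minus_commute: "lp_norm p (x - y) = lp_norm p (y - x)"
  by (simp add: lp_norm_def abs_minus_commute)

lemma lp_norm_sums:
  assumes "x \<in> lp_space p" "p \<ge> 1"
  shows "(\<lambda>k. \<bar>x k\<bar> powr p) sums (lp_norm p x powr p)"
proof -
  have "0 \<le> (\<Sum>k. \<bar>x k\<bar> powr p)" using assms by (intro suminf_nonneg) (auto simp: lp_space_def)
  then have "lp_norm p x powr p = (\<Sum>k. \<bar>x k\<bar> powr p)"
    using assms by (simp add: lp_norm_def powr_powr)
  then show ?thesis using assms by (simp add: lp_space_def summable_sums)
qed

text \<open>Minkowski's inequality as convexity of the unit ball: \<open>x / a\<close> and
  \<open>y / b\<close> are combined with weights \<open>a / (a + b)\<close> and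
  \<open>b / (a + b)\<close>. Strictly positive bounds in place of the norms avoid division by
  zero.\<close>

lemma lp_add_bound:
  assumes x: "x \<in> lp_space p" and y: "y \<in> lp_space p" and p: "p \<ge> 1"
    and a: "lp_norm p x \<le> a" "a > 0" and b: "lp_norm p y \<le> b" "b > 0"
  shows "(\<lambda>k. x k + y k) \<in> lp_space p \<and> lp_norm p (\<lambda>k. x k + y k) \<le> a + b"
proof -
  define t where "t = b / (a + b)"
  have t: "0 \<le> t" "t \<le> 1" and at: "(a + b) * (1 - t) = a" and bt: "(a + b) * t = b"
    using a b by (auto simp: t_def field_simps)
  let ?g = "\<lambda>k. (a + b) powr p * ((1 - t) * (\<bar>x k\<bar> / a) powr p + t * (\<bar>y k\<bar> / b) powr p)"
  have le: "\<bar>x k + y k\<bar> powr p \<le> ?g k" for k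
  proof -
    have "(a + b) * ((1 - t) * (\<bar>x k\<bar> / a) + t * (\<bar>y k\<bar> / b))
        = ((a + b) * (1 - t)) * (\<bar>x k\<bar> / a) + ((a + b) * t) * (\<bar>y k\<bar> / b)"
      by (simp only: distrib_left mult.assoc)
    also have "\<dots> = \<bar>x k\<bar> + \<bar>y k\<bar>" unfolding at bt using a b by simp
    finally have "\<bar>x k + y k\<bar> powr p
        \<le> ((a + b) * ((1 - t) * (\<bar>x k\<bar> / a) + t * (\<bar>y k\<bar> / b))) powr p"
      using p by (intro powr_mono2) auto
    also have "\<dots> \<le> ?g k" unfolding powr_mult[of "a + b"]
      using t p a b by (intro mult_left_mono powr_convex_nonneg) auto
    finally show ?thesis .
  qed
  let ?G = "(a + b) powr p * ((1 - t) * (lp_norm p x / a) powr p + t * (lp_norm p y / b) powr p)"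
  have g: "?g sums ?G"
    unfolding powr_divide by (intro sums_mult sums_add sums_divide lp_norm_sums x y p)
  have "?G \<le> (a + b) powr p * ((1 - t) * 1 + t * 1)"
    using a b t p by (intro mult_left_mono add_mono powr_le1) (auto simp: lp_norm_nonneg)
  then have G: "?G \<le> (a + b) powr p" by simp
  have sm: "summable (\<lambda>k. \<bar>x k + y k\<bar> powr p)"
    using le by (intro summable_comparison_test'[OF sums_summable[OF g]]) auto
  have "(\<Sum>k. \<bar>x k + y k\<bar> powr p) \<le> (a + b) powr p"
    using sums_le[OF le summable_sums[OF sm] g] G by linarith
  then have "lp_norm p (\<lambda>k. x k + y k) \<le> ((a + b) powr p) powr (1 / p)"
    unfolding lp_norm_def using p sm by (intro powr_mono2 suminf_nonneg) auto
  then show ?thesis using sm a b p by (simp add: lp_space_def powr_powr)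
qed

lemma lp_norm_triangle:
  assumes "x \<in> lp_space p" "y \<in> lp_space p" "p \<ge> 1"
  shows "lp_norm p (\<lambda>k. x k + y k) \<le> lp_norm p x + lp_norm p y"
proof (rule field_le_epsilon)
  fix e :: real assume e: "e > 0"
  have "lp_norm p (\<lambda>k. x k + y k) \<le> (lp_norm p x + e / 2) + (lp_norm p y + e / 2)"
    using lp_add_bound[OF assms, of "lp_norm p x + e / 2" "lp_norm p y + e / 2"] e
      lp_norm_nonneg[of p x] lp_norm_nonneg[of p y] by simp
  then show "lp_norm p (\<lambda>k. x k + y k) \<le> lp_norm p x + lp_norm p y + e" by simp
qed

lemma lp_space_diff:
  assumes "x \<in> lp_space p" "y \<in> lp_space p" "p \<ge> 1"
  shows "x - y \<in> lp_space p"
proof -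
  have "- y \<in> lp_space p" using assms(2) by (simp add: lp_space_def)
  then show ?thesis
    using lp_add_bound[OF assms(1), of "- y" "lp_norm p x + 1" "lp_norm p (- y) + 1"] assms(3)
      lp_norm_nonneg[of p x] lp_norm_nonneg[of p "- y"]
    by (simp add: fun_diff_def)
qed

lemma lp_norm_diff_triangle:
  assumes "x \<in> lp_space p" "y \<in> lp_space p" "z \<in> lp_space p" "p \<ge> 1"
  shows "lp_norm p (x - z) \<le> lp_norm p (x - y) + lp_norm p (y - z)"
  using lp_norm_triangle[of "x - y" p "y - z"] assms
  by (simp add: lp_space_diff) (simp add: fun_diff_def)

lemma lp_norm_diff_le:
  assumes "x \<in> lp_space p" "y \<in> lp_space p" "z \<in> lp_space p" "p \<ge> 1"
  shows "\<bar>lp_norm p (x - z) - lp_norm p (y - z)\<bar> \<le> lp_norm p (x - y)"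
  using lp_norm_diff_triangle[of x p y z] lp_norm_diff_triangle[of y p x z]
    lp_norm_minus_commute[of p x y] assms by linarith

subsection \<open>Distances between images of the cube\<close>

text \<open>The first weight is multiplied once per coordinate and stays bounded because
  \<open>(1 + 1 / d) ^ d\<close> is at most \<open>exp 1\<close>. The second is paid in each of
  \<open>d\<close> directions, and \<open>d + 1 \<le> 2 * d\<close> gives a total of order
  \<open>(p * d) powr (p / 2)\<close>.\<close>

lemma two_point_constants:
  fixes p :: real and d :: nat
  assumes p: "p \<ge> 2" and d: "d \<ge> 1"
  shows "((1 + 1 / real d) powr (p / 2 - 1)) ^ d \<le> exp (p / 2)"
    and "(real d + 1) powr (p / 2 - 1) * (3 * p) powr (p / 2) * real d \<le> (6 * p * d) powr (p / 2)"
proof -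
  have "(1 + 1 / real d) powr (p / 2 - 1) \<le> exp (1 / real d) powr (p / 2 - 1)"
    using p by (intro powr_mono2) auto
  then have "((1 + 1 / real d) powr (p / 2 - 1)) ^ d \<le> (exp (1 / real d) powr (p / 2 - 1)) ^ d"
    by (intro power_mono) auto
  also have "\<dots> = exp (p / 2 - 1)"
    using d by (simp add: exp_powr_real flip: exp_of_nat_mult)
  also have "\<dots> \<le> exp (p / 2)" by simp
  finally show "((1 + 1 / real d) powr (p / 2 - 1)) ^ d \<le> exp (p / 2)" .
  have "(real d + 1) powr (p / 2 - 1) * real d \<le> (2 * real d) powr (p / 2 - 1) * (2 * real d)"
    using p d by (intro mult_mono powr_mono2) auto
  also have "\<dots> = (2 * real d) powr (p / 2)"
    using powr_mult_base[of "2 * real d" "p / 2 - 1"] by (simp add: mult.commute)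
  finally have "(real d + 1) powr (p / 2 - 1) * real d * (3 * p) powr (p / 2)
      \<le> (2 * real d) powr (p / 2) * (3 * p) powr (p / 2)"
    by (intro mult_right_mono) auto
  then show "(real d + 1) powr (p / 2 - 1) * (3 * p) powr (p / 2) * real d
      \<le> (6 * p * d) powr (p / 2)"
    by (simp add: mult_ac flip: powr_mult)
qed

text \<open>Concentration in moment form: \<open>cube_poincare\<close> with centre \<open>0\<close>
  and energy at most \<open>card A * L powr p\<close>. After taking \<open>p\<close>-th roots the
  fluctuation grows like \<open>sqrt p\<close>, as for a Gaussian.\<close>

lemma cube_lipschitz_moment:
  fixes p L :: real
  assumes A: "finite A" "A \<noteq> {}" and p: "p \<ge> 2" and L: "L \<ge> 0"
    and lip: "\<And>S k. S \<subseteq> A \<Longrightarrow> k \<in> A \<Longrightarrow> \<bar>g (insert k S) - g (S - {k})\<bar> \<le> L"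
  shows "cube_avg A (\<lambda>S. \<bar>g S\<bar> powr p)
    \<le> exp (p / 2) * (\<bar>cube_avg A g\<bar> powr p + (sqrt (6 * p * card A) * L) powr p)"
proof -
  define d where "d = card A"
  define \<alpha> where "\<alpha> = (1 + 1 / real d) powr (p / 2 - 1)"
  define \<beta> where "\<beta> = (real d + 1) powr (p / 2 - 1) * (3 * p) powr (p / 2)"
  have d: "d \<ge> 1" using A by (simp add: d_def Suc_leI card_gt_0_iff)
  have \<alpha>: "\<alpha> \<ge> 1" using p by (simp add: \<alpha>_def ge_one_powr_ge_zero)
  have \<beta>: "\<beta> \<ge> 0" by (simp add: \<beta>_def)
  have "edge_energy p A g \<le> (\<Sum>k\<in>A. cube_avg A (\<lambda>S. L powr p))"
    unfolding edge_energy_def using lip p by (intro sum_mono cube_avg_mono powr_mono2) auto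
  then have "\<beta> * edge_energy p A g \<le> \<beta> * (real d * L powr p)"
    using A \<beta> by (intro mult_left_mono) (auto simp: d_def)
  also have "\<dots> = \<beta> * real d * L powr p" by simp
  also have "\<dots> \<le> (6 * p * d) powr (p / 2) * L powr p"
    using two_point_constants(2)[OF p d] by (intro mult_right_mono) (auto simp: \<beta>_def)
  also have "\<dots> = (sqrt (6 * p * d) * L) powr p"
    using p by (simp add: powr_mult powr_powr flip: powr_half_sqrt)
  finally have energy: "\<beta> * edge_energy p A g \<le> (sqrt (6 * p * d) * L) powr p" .
  have "cube_avg A (\<lambda>S. \<bar>g S - 0\<bar> powr p)
      \<le> \<alpha> ^ card A * (\<bar>cube_avg A g - 0\<bar> powr p + \<beta> * edge_energy p A g)"
  proof (rule cube_poincare[OF A(1) _ \<alpha> \<beta>])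
    show "(\<bar>a + b\<bar> powr p + \<bar>a - b\<bar> powr p) / 2 \<le> \<alpha> * \<bar>a\<bar> powr p + \<beta> * \<bar>b\<bar> powr p" for a b
      unfolding \<alpha>_def \<beta>_def using d by (intro two_point_ge_two_split p) auto
  qed (use p in simp)
  also have "\<dots> \<le> exp (p / 2) * (\<bar>cube_avg A g - 0\<bar> powr p + (sqrt (6 * p * d) * L) powr p)"
    using two_point_constants(1)[OF p d] energy \<beta>
    by (intro mult_mono add_mono add_nonneg_nonneg mult_nonneg_nonneg edge_energy_nonneg)
      (auto simp: \<alpha>_def d_def)
  finally show ?thesis by (simp add: d_def)
qed

text \<open>The \<open>q\<close>-th power of the norm is a sum over coordinates, so the scalar
  inequality is applied to each coordinate of \<open>f\<close> and summed.\<close>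

lemma cube_lp_pairs_poincare:
  fixes f :: "nat set \<Rightarrow> nat \<Rightarrow> real" and q \<alpha> \<beta> L :: real
  assumes A: "finite A" and q: "q \<ge> 1" and f: "\<And>S. S \<subseteq> A \<Longrightarrow> f S \<in> lp_space q"
    and lip: "\<And>S k. S \<subseteq> A \<Longrightarrow> k \<in> A \<Longrightarrow> lp_norm q (f (insert k S) - f (S - {k})) \<le> L"
    and \<alpha>: "\<alpha> \<ge> 1" and \<beta>: "\<beta> \<ge> 0"
    and two_point: "\<And>a b. (\<bar>a + b\<bar> powr q + \<bar>a - b\<bar> powr q) / 2
      \<le> \<alpha> * \<bar>a\<bar> powr q + \<beta> * \<bar>b\<bar> powr q"
  shows "cube_avg A (\<lambda>T. cube_avg A (\<lambda>S. lp_norm q (f S - f T) powr q))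
    \<le> 2 * \<alpha> ^ card A * \<alpha> ^ card A * \<beta> * (real (card A) * L powr q)"
proof -
  let ?C = "2 * \<alpha> ^ card A * \<alpha> ^ card A * \<beta>"
  let ?N = "\<lambda>S T. lp_norm q (f S - f T) powr q"
  have sums: "(\<lambda>i. \<bar>f S i - f T i\<bar> powr q) sums ?N S T" if "S \<subseteq> A" "T \<subseteq> A" for S T
    using lp_norm_sums[OF lp_space_diff[OF f[OF that(1)] f[OF that(2)] q] q] by simp
  have pairs: "(\<lambda>i. cube_avg A (\<lambda>T. cube_avg A (\<lambda>S. \<bar>f S i - f T i\<bar> powr q)))
      sums cube_avg A (\<lambda>T. cube_avg A (\<lambda>S. ?N S T))"
    by (intro cube_avg_sums sums)
  have "(\<lambda>i. edge_energy q A (\<lambda>S. f S i))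
      sums (\<Sum>k\<in>A. cube_avg A (\<lambda>S. ?N (insert k S) (S - {k})))"
    unfolding edge_energy_def by (intro sums_sum cube_avg_sums sums) auto
  then have edges: "(\<lambda>i. ?C * edge_energy q A (\<lambda>S. f S i))
      sums (?C * (\<Sum>k\<in>A. cube_avg A (\<lambda>S. ?N (insert k S) (S - {k}))))"
    by (rule sums_mult)
  have "cube_avg A (\<lambda>T. cube_avg A (\<lambda>S. ?N S T))
      \<le> ?C * (\<Sum>k\<in>A. cube_avg A (\<lambda>S. ?N (insert k S) (S - {k})))"
    using cube_pairs_poincare[OF A q \<alpha> \<beta> two_point] by (intro sums_le[OF _ pairs edges]) auto
  also have "\<dots> \<le> ?C * (\<Sum>k\<in>A. cube_avg A (\<lambda>S. L powr q))"
    using lip \<alpha> \<beta> q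
    by (intro mult_left_mono sum_mono cube_avg_mono powr_mono2) (auto simp: lp_norm_nonneg)
  also have "\<dots> = ?C * (real (card A) * L powr q)" using A by simp
  finally show ?thesis .
qed

lemma cube_pairs_jensen:
  assumes A: "finite A" and p: "p \<ge> 1" and "\<And>S T. 0 \<le> g S T"
  shows "cube_avg A (\<lambda>T. cube_avg A (\<lambda>S. g S T)) powr p
    \<le> cube_avg A (\<lambda>T. cube_avg A (\<lambda>S. g S T powr p))"
proof -
  have nonneg: "0 \<le> cube_avg A (\<lambda>S. g S T)" for T
    using assms(3) by (rule cube_avg_nonneg)
  have "cube_avg A (\<lambda>T. cube_avg A (\<lambda>S. g S T)) powr p
      \<le> cube_avg A (\<lambda>T. cube_avg A (\<lambda>S. g S T) powr p)"
    using cube_avg_jensen[OF A p, of "\<lambda>T. cube_avg A (\<lambda>S. g S T)"] nonneg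
      cube_avg_nonneg[of A "\<lambda>T. cube_avg A (\<lambda>S. g S T)"] by simp
  also have "\<dots> \<le> cube_avg A (\<lambda>T. cube_avg A (\<lambda>S. g S T powr p))"
  proof (rule cube_avg_mono)
    show "cube_avg A (\<lambda>S. g S T) powr p \<le> cube_avg A (\<lambda>S. g S T powr p)" for T
      using cube_avg_jensen[OF A p, of "\<lambda>S. g S T"] nonneg[of T] assms(3) by simp
  qed
  finally show ?thesis .
qed

lemma powr_le_powr_cancel:
  fixes a b p :: real
  assumes "a powr p \<le> b powr p" "p > 0" "b \<ge> 0"
  shows "a \<le> b"
  using powr_less_mono2[of p b a] assms by (meson not_le)

lemma cube_lp_mean_distance:
  fixes f :: "nat set \<Rightarrow> nat \<Rightarrow> real" and q L :: real
  assumes A: "finite A" "A \<noteq> {}" and q: "q \<ge> 1" and f: "\<And>S. S \<subseteq> A \<Longrightarrow> f S \<in> lp_space q"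
    and lip: "\<And>S k. S \<subseteq> A \<Longrightarrow> k \<in> A \<Longrightarrow> lp_norm q (f (insert k S) - f (S - {k})) \<le> L"
    and L: "L \<ge> 0"
  shows "cube_avg A (\<lambda>T. cube_avg A (\<lambda>S. lp_norm q (f S - f T)))
    \<le> 15 * sqrt q * card A powr (1 / min q 2) * L"
proof -
  define d where "d = card A"
  have d: "d \<ge> 1" using A by (simp add: d_def Suc_leI card_gt_0_iff)
  define M where "M = cube_avg A (\<lambda>T. cube_avg A (\<lambda>S. lp_norm q (f S - f T)))"
  note P = cube_lp_pairs_poincare[OF A(1) q f lip]
  have Mq: "M powr q \<le> cube_avg A (\<lambda>T. cube_avg A (\<lambda>S. lp_norm q (f S - f T) powr q))"
    unfolding M_def using A q by (intro cube_pairs_jensen) (auto simp: lp_norm_nonneg)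
  have two: "2 \<le> 2 powr q" using q powr_mono[of 1 q 2] by simp
  show ?thesis
  proof (cases "q \<le> 2")
    case True
    \<comment> \<open>For \<open>q \<le> 2\<close> the two-point inequality has
      \<open>\<alpha> = \<beta> = 1\<close>.\<close>
    have "M powr q \<le> 2 * 1 ^ card A * 1 ^ card A * 1 * (real (card A) * L powr q)"
      using two_point_le_two[OF q True] by (intro order_trans[OF Mq P]) auto
    also have "\<dots> = 2 * (d * L powr q)" by (simp add: d_def)
    also have "\<dots> \<le> 2 powr q * (d * L powr q)" using two by (intro mult_right_mono) auto
    also have "\<dots> = (2 * d powr (1 / q) * L) powr q"
      using q by (simp add: powr_mult powr_powr)
    finally have "M \<le> 2 * d powr (1 / q) * L"
      by (rule powr_le_powr_cancel) (use q L in auto)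
    also have "\<dots> \<le> 15 * sqrt q * d powr (1 / q) * L"
    proof -
      have "2 \<le> 15 * sqrt q" using real_sqrt_ge_one[OF q] by linarith
      then show ?thesis using L by (intro mult_right_mono) auto
    qed
    finally show ?thesis using True by (simp add: M_def d_def min_def)
  next
    case False
    then have q2: "q \<ge> 2" by simp
    define \<alpha> where "\<alpha> = (1 + 1 / real d) powr (q / 2 - 1)"
    define \<beta> where "\<beta> = (real d + 1) powr (q / 2 - 1) * (3 * q) powr (q / 2)"
    have \<alpha>: "\<alpha> \<ge> 1" using q2 by (simp add: \<alpha>_def ge_one_powr_ge_zero)
    have \<beta>: "\<beta> \<ge> 0" by (simp add: \<beta>_def)
    have tp: "(\<bar>a + b\<bar> powr q + \<bar>a - b\<bar> powr q) / 2 \<le> \<alpha> * \<bar>a\<bar> powr q + \<beta> * \<bar>b\<bar> powr q"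
      for a b unfolding \<alpha>_def \<beta>_def using d by (intro two_point_ge_two_split q2) auto
    have "M powr q \<le> 2 * \<alpha> ^ card A * \<alpha> ^ card A * \<beta> * (real (card A) * L powr q)"
      using tp \<alpha> \<beta> by (intro order_trans[OF Mq P]) auto
    also have "\<dots> = 2 * (\<alpha> ^ d * \<alpha> ^ d) * ((\<beta> * d) * L powr q)" by (simp add: d_def)
    also have "\<dots> \<le> 2 * (exp (q / 2) * exp (q / 2)) * ((6 * q * d) powr (q / 2) * L powr q)"
      using two_point_constants[OF q2 d] \<alpha> \<beta> unfolding \<alpha>_def[symmetric] \<beta>_def[symmetric]
      by (intro mult_mono mult_nonneg_nonneg) auto
    also have "exp (q / 2) * exp (q / 2) = exp 1 powr q"
      by (simp add: exp_powr_real mult_exp_exp)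
    also have "2 * exp 1 powr q * ((6 * q * d) powr (q / 2) * L powr q)
        \<le> 2 powr q * 3 powr q * ((6 * q * d) powr (q / 2) * L powr q)"
      using two q exp_le by (intro mult_right_mono mult_mono powr_mono2) auto
    also have "\<dots> = (6 * sqrt (6 * q * d) * L) powr q"
      using q powr_mult[of 2 3 q] by (simp add: powr_mult powr_powr flip: powr_half_sqrt)
    finally have "M \<le> 6 * sqrt (6 * q * d) * L"
      by (rule powr_le_powr_cancel) (use q L in auto)
    also have "\<dots> \<le> 6 * (5 / 2 * sqrt q * d powr (1 / 2)) * L"
    proof -
      have "sqrt 6 \<le> 5 / 2" by (intro real_le_lsqrt) (auto simp: power2_eq_square)
      then have "sqrt 6 * (sqrt q * sqrt d) \<le> 5 / 2 * (sqrt q * sqrt d)"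
        using q by (intro mult_right_mono) auto
      then have "sqrt (6 * q * d) \<le> 5 / 2 * sqrt q * d powr (1 / 2)"
        by (simp add: real_sqrt_mult powr_half_sqrt mult.assoc)
      then show ?thesis using L by (intro mult_right_mono mult_left_mono) auto
    qed
    finally show ?thesis using False by (simp add: M_def d_def min_def)
  qed
qed

text \<open>The mean distance is controlled coordinatewise, the deviation from it by concentration of
  the scalar function \<open>S \<mapsto> \<parallel>f S - f T\<parallel>\<close>, which is \<open>L\<close>-Lipschitz, first in \<open>S\<close> and then, after
  averaging over \<open>S\<close>, in \<open>T\<close>.\<close>

lemma cube_lp_moment_distance:
  fixes f :: "nat set \<Rightarrow> nat \<Rightarrow> real" and q r L :: real
  assumes A: "finite A" "A \<noteq> {}" and q: "q \<ge> 1" and r: "r \<ge> 1"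
    and f: "\<And>S. S \<subseteq> A \<Longrightarrow> f S \<in> lp_space q"
    and lip: "\<And>S k. S \<subseteq> A \<Longrightarrow> k \<in> A \<Longrightarrow> lp_norm q (f (insert k S) - f (S - {k})) \<le> L"
    and L: "L \<ge> 0"
  shows "cube_avg A (\<lambda>T. cube_avg A (\<lambda>S. lp_norm q (f S - f T) powr r)) powr (1 / r)
    \<le> 270 * sqrt (q + r) * card A powr (1 / min q 2) * L"
proof -
  define d where "d = card A"
  have d: "d \<ge> 1" using A by (simp add: d_def Suc_leI card_gt_0_iff)
  \<comment> \<open>Concentration needs an exponent of at least 2. The doubled exponent satisfies
    this for every \<open>r \<ge> 1\<close>, and Jensen leads back to \<open>r\<close> at the
    end.\<close>
  define \<rho> where "\<rho> = 2 * r"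
  have \<rho>: "\<rho> \<ge> 2" using r by (simp add: \<rho>_def)
  define D where "D = d powr (1 / min q 2)"
  \<comment> \<open>A common bound for the mean distance and for the fluctuation around it.\<close>
  define W where "W = 15 * sqrt (q + \<rho>) * D * L"
  define F where "F S T = lp_norm q (f S - f T)" for S T
  have F0: "F S T \<ge> 0" for S T by (simp add: F_def lp_norm_nonneg)
  define h where "h T = cube_avg A (\<lambda>S. F S T)" for T
  have h0: "h T \<ge> 0" for T unfolding h_def using F0 by (rule cube_avg_nonneg)
  let ?B = "(sqrt (6 * \<rho> * card A) * L) powr \<rho>" and ?e = "exp (\<rho> / 2)"
  have F_lip: "\<bar>F (insert k S) T - F (S - {k}) T\<bar> \<le> L"
    if "S \<subseteq> A" "T \<subseteq> A" "k \<in> A" for S T k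
  proof -
    have "\<bar>F (insert k S) T - F (S - {k}) T\<bar> \<le> lp_norm q (f (insert k S) - f (S - {k}))"
      unfolding F_def using that by (intro lp_norm_diff_le f q) auto
    then show ?thesis using lip[OF that(1,3)] by simp
  qed
  have F_sym: "F S T = F T S" for S T unfolding F_def by (rule lp_norm_minus_commute)
  have h_lip: "\<bar>h (insert k T) - h (T - {k})\<bar> \<le> L" if T: "T \<subseteq> A" "k \<in> A" for T k
  proof -
    have "\<bar>h (insert k T) - h (T - {k})\<bar>
        = \<bar>cube_avg A (\<lambda>S. F S (insert k T) - F S (T - {k}))\<bar> powr 1"
      unfolding h_def by (simp add: cube_avg_diff)
    also have "\<dots> \<le> cube_avg A (\<lambda>S. \<bar>F S (insert k T) - F S (T - {k})\<bar> powr 1)"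
      using A by (intro cube_avg_jensen) auto
    also have "\<dots> \<le> cube_avg A (\<lambda>S. L)"
      using F_lip[OF T(1) _ T(2)] F_sym by (intro cube_avg_mono) auto
    finally show ?thesis using A by simp
  qed
  \<comment> \<open>The fluctuation has order \<open>sqrt d\<close> in the dimension, hence never
    exceeds the scale \<open>D\<close> of the mean.\<close>
  have D: "sqrt d \<le> D"
  proof -
    have "1 / 2 \<le> 1 / min q 2" using q by (intro divide_left_mono) auto
    then show ?thesis using d by (simp add: D_def powr_mono flip: powr_half_sqrt)
  qed
  have B: "?B \<le> W powr \<rho>"
  proof -
    have "sqrt (6 * \<rho> * d) = sqrt 6 * sqrt \<rho> * sqrt d" by (simp add: real_sqrt_mult)
    also have "\<dots> \<le> 15 * sqrt (q + \<rho>) * D"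
      using q \<rho> D real_le_lsqrt[of 15 6] by (intro mult_mono) auto
    finally have "sqrt (6 * \<rho> * d) * L \<le> W"
      unfolding W_def using L by (intro mult_right_mono) auto
    then show ?thesis using \<rho> L by (intro powr_mono2) (auto simp: d_def)
  qed
  have mean: "cube_avg A h powr \<rho> \<le> W powr \<rho>"
  proof (rule powr_mono2)
    have "cube_avg A h \<le> 15 * sqrt q * D * L"
      unfolding h_def F_def D_def d_def by (intro cube_lp_mean_distance assms)
    also have "\<dots> \<le> W"
      unfolding W_def using \<rho> L by (intro mult_right_mono) (auto simp: D_def)
    finally show "cube_avg A h \<le> W" .
  qed (use \<rho> h0 in \<open>auto intro: cube_avg_nonneg\<close>)
  have "cube_avg A (\<lambda>T. cube_avg A (\<lambda>S. F S T powr \<rho>))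
      \<le> cube_avg A (\<lambda>T. ?e * (h T powr \<rho> + ?B))"
  proof (rule cube_avg_mono)
    fix T assume T: "T \<subseteq> A"
    show "cube_avg A (\<lambda>S. F S T powr \<rho>) \<le> ?e * (h T powr \<rho> + ?B)"
      using cube_lipschitz_moment[OF A \<rho> L, of "\<lambda>S. F S T"] F_lip[OF _ T] F0 h0[of T]
      by (simp add: h_def)
  qed
  also have "\<dots> = ?e * (cube_avg A (\<lambda>T. h T powr \<rho>) + ?B)"
    using A(1) by (simp only: cube_avg_cmult cube_avg_add cube_avg_const)
  also have "\<dots> \<le> ?e * (?e * (cube_avg A h powr \<rho> + ?B) + ?B)"
    using cube_lipschitz_moment[OF A \<rho> L, of h] h_lip h0 cube_avg_nonneg[of A h]
    by (intro mult_left_mono add_right_mono) auto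
  also have "\<dots> \<le> ?e * (?e * (W powr \<rho> + W powr \<rho>) + ?e * W powr \<rho>)"
    using mean B mult_mono[of 1 ?e ?B "W powr \<rho>"] \<rho>
    by (intro mult_left_mono add_mono) auto
  also have "\<dots> = 3 * (?e * ?e) * W powr \<rho>" by simp
  also have "?e * ?e = exp 1 powr \<rho>" by (simp add: exp_powr_real mult_exp_exp)
  \<comment> \<open>With \<open>3 \<le> 4 powr \<rho>\<close> and \<open>exp 1 \<le> 3\<close> the
    constant becomes 12; the final one is \<open>12 * 15 * (3 / 2) = 270\<close>.\<close>
  also have "3 * exp 1 powr \<rho> * W powr \<rho> \<le> 4 powr \<rho> * 3 powr \<rho> * W powr \<rho>"
    using \<rho> exp_le powr_mono[of 1 \<rho> 4] by (intro mult_right_mono mult_mono powr_mono2) auto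
  also have "\<dots> = (12 * W) powr \<rho>" by (simp flip: powr_mult)
  finally have high: "cube_avg A (\<lambda>T. cube_avg A (\<lambda>S. F S T powr \<rho>)) \<le> (12 * W) powr \<rho>" .
  define R where "R = cube_avg A (\<lambda>T. cube_avg A (\<lambda>S. F S T powr r))"
  have R0: "R \<ge> 0" unfolding R_def by (intro cube_avg_nonneg) auto
  have "R powr 2 \<le> cube_avg A (\<lambda>T. cube_avg A (\<lambda>S. (F S T powr r) powr 2))"
    unfolding R_def using A by (intro cube_pairs_jensen) auto
  also have "\<dots> \<le> (12 * W) powr \<rho>" using high by (simp add: powr_powr \<rho>_def mult.commute)
  finally have "(R powr 2) powr (1 / \<rho>) \<le> ((12 * W) powr \<rho>) powr (1 / \<rho>)"
    using \<rho> by (intro powr_mono2) auto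
  moreover have "W \<ge> 0" using L q \<rho> by (simp add: W_def D_def)
  ultimately have "R powr (1 / r) \<le> 12 * W" using r \<rho> by (simp add: powr_powr \<rho>_def)
  also have "\<dots> \<le> 12 * (15 * (3 / 2 * sqrt (q + r)) * D * L)"
  proof -
    have "sqrt (q + \<rho>) \<le> sqrt ((3 / 2)\<^sup>2 * (q + r))"
      using q r by (simp add: \<rho>_def power2_eq_square)
    also have "\<dots> = 3 / 2 * sqrt (q + r)" by (subst real_sqrt_mult) simp
    finally show ?thesis
      unfolding W_def using L by (intro mult_left_mono mult_right_mono) (auto simp: D_def)
  qed
  finally show ?thesis by (simp add: R_def F_def D_def d_def mult_ac)
qed

section \<open>The cube in \<open>lp_space p\<close> and its Hamming distances\<close>

lemma indicator_powr_sums: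
  fixes S T :: "nat set"
  assumes "finite S" "finite T"
  shows "(\<lambda>k. \<bar>indicator S k - indicator T k :: real\<bar> powr p) sums (card (sym_diff S T))"
proof -
  have "(\<lambda>k. \<bar>indicator S k - indicator T k :: real\<bar> powr p) = (\<lambda>k. if k \<in> sym_diff S T then 1 else 0)"
    by (auto simp: fun_eq_iff indicator_def)
  then show ?thesis using sums_If_finite_set[of "sym_diff S T" "\<lambda>_. 1 :: real"] assms by simp
qed

text \<open>The difference of two indicators is \<open>1\<close> or \<open>-1\<close> exactly on the
  symmetric difference. In particular edges of the cube have length \<open>1\<close> for every
  \<open>p\<close>.\<close>

lemma lp_norm_indicator_diff:
  fixes S T :: "nat set"
  assumes "finite S" "finite T"
  shows "lp_norm p (indicator S - indicator T) = card (sym_diff S T) powr (1 / p)"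
  using sums_unique[OF indicator_powr_sums[OF assms]] by (simp add: lp_norm_def)

lemma indicator_in_lp_space: "finite S \<Longrightarrow> indicator S \<in> lp_space p" for S :: "nat set"
  using indicator_powr_sums[of S "{}" p] by (simp add: lp_space_def sums_summable)

lemma cube_avg_compl:
  assumes "finite A"
  shows "cube_avg A (\<lambda>S. g (A - S)) = cube_avg A g"
proof -
  have "bij_betw (\<lambda>S. A - S) (Pow A) (Pow A)"
    by (rule bij_betw_byWitness[where f' = "\<lambda>S. A - S"]) auto
  then show ?thesis
    using sum.reindex_bij_betw[of "\<lambda>S. A - S" "Pow A" "Pow A" g] by (simp add: cube_avg_def)
qed

text \<open>Pairing \<open>S\<close> with its complement: one of the two is at distance at least \<open>|A| / 2\<close> from \<open>T\<close>.\<close>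

lemma cube_hamming_moment:
  fixes p s :: real
  assumes A: "finite A" and p: "p \<ge> 1" and s: "s \<ge> 1"
  shows "card A powr (1 / p) / 4 \<le>
    cube_avg A (\<lambda>T. cube_avg A (\<lambda>S. (card (sym_diff S T) powr (1 / p)) powr s)) powr (1 / s)"
proof -
  define w where "w = card A powr (1 / p) / 2"
  have w0: "w \<ge> 0" by (simp add: w_def)
  let ?u = "\<lambda>S T. (card (sym_diff S T) powr (1 / p)) powr s"
  have large: "w powr s \<le> (real m powr (1 / p)) powr s" if "card A \<le> 2 * m" for m
  proof -
    have "card A powr (1 / p) \<le> (2 * m) powr (1 / p)"
      using p that by (intro powr_mono2) auto
    also have "\<dots> \<le> 2 * m powr (1 / p)"
      using p powr_mono[of "1 / p" 1 2] by (simp add: powr_mult mult_right_mono)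
    finally show ?thesis using s w0 by (intro powr_mono2) (auto simp: w_def)
  qed
  have pair: "w powr s \<le> ?u S T + ?u (A - S) T" if "S \<subseteq> A" "T \<subseteq> A" for S T
  proof -
    \<comment> \<open>The two symmetric differences together cover \<open>A\<close>.\<close>
    have "card A \<le> card (sym_diff S T \<union> sym_diff (A - S) T)"
      using A that by (intro card_mono) (auto intro: finite_subset)
    also have "\<dots> \<le> card (sym_diff S T) + card (sym_diff (A - S) T)" by (rule card_Un_le)
    finally consider "card A \<le> 2 * card (sym_diff S T)" | "card A \<le> 2 * card (sym_diff (A - S) T)"
      by linarith
    then have "w powr s \<le> ?u S T \<or> w powr s \<le> ?u (A - S) T" by cases (simp_all only: large simp_thms)
    moreover have "?u S T \<ge> 0" "?u (A - S) T \<ge> 0" by simp_all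
    ultimately show ?thesis by linarith
  qed
  have "w powr s \<le> 2 * cube_avg A (\<lambda>S. ?u S T)" if "T \<subseteq> A" for T
  proof -
    have "cube_avg A (\<lambda>S. w powr s) \<le> cube_avg A (\<lambda>S. ?u S T + ?u (A - S) T)"
      using pair that by (intro cube_avg_mono) auto
    also have "\<dots> = 2 * cube_avg A (\<lambda>S. ?u S T)"
      using cube_avg_compl[OF A, of "\<lambda>S. ?u S T"] by (simp add: cube_avg_add)
    finally show ?thesis using A by simp
  qed
  then have "cube_avg A (\<lambda>T. w powr s / 2) \<le> cube_avg A (\<lambda>T. cube_avg A (\<lambda>S. ?u S T))"
    by (intro cube_avg_mono) (auto simp: mult.commute)
  then have avg: "w powr s / 2 \<le> cube_avg A (\<lambda>T. cube_avg A (\<lambda>S. ?u S T))" using A by simp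
  \<comment> \<open>The factor 1/2 lost by pairing costs at most another 1/2 after the
    \<open>s\<close>-th root; with the one in \<open>w\<close> this gives 1/4.\<close>
  have "(w / 2) powr s \<le> w powr s / 2"
    unfolding powr_divide using s powr_mono[of 1 s 2] by (intro divide_left_mono) auto
  then have "((w / 2) powr s) powr (1 / s)
      \<le> cube_avg A (\<lambda>T. cube_avg A (\<lambda>S. ?u S T)) powr (1 / s)"
    using avg s by (intro powr_mono2) auto
  then show ?thesis using s w0 by (simp add: powr_powr w_def)
qed

section \<open>From indexed families to functions on the cube, and the conclusion\<close>

lemma avg_dist_eq_cube_avg:
  assumes "bij_betw e {1..2 ^ card A} (Pow A)"
  shows "avg_dist p s (2 ^ card A) (\<lambda>i. f (e i))
    = cube_avg A (\<lambda>T. cube_avg A (\<lambda>S. lp_norm p (f S - f T) powr s)) powr (1 / s)"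
proof -
  let ?G = "\<lambda>T. \<Sum>S\<in>Pow A. lp_norm p (f T - f S) powr s"
  have re: "(\<Sum>i = 1..2 ^ card A. g (e i)) = (\<Sum>S\<in>Pow A. g S)" for g :: "nat set \<Rightarrow> real"
    using sum.reindex_bij_betw[OF assms] .
  have "(\<Sum>j = 1..2 ^ card A. lp_norm p (f T - f (e j)) powr s) = ?G T" for T
    using re[of "\<lambda>S. lp_norm p (f T - f S) powr s"] .
  then have "(\<Sum>i = 1..2 ^ card A. \<Sum>j = 1..2 ^ card A. lp_norm p (f (e i) - f (e j)) powr s)
      = (\<Sum>T\<in>Pow A. ?G T)"
    using re[of ?G] by simp
  then show ?thesis
    unfolding avg_dist_def cube_avg_def lp_norm_minus_commute[of p "f S" "f T" for S T]
    by (simp add: power2_eq_square flip: sum_divide_distrib)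
qed

lemma avg_dist_cong:
  assumes "\<And>i. i \<in> {1..n} \<Longrightarrow> x i = y i"
  shows "avg_dist p s n x = avg_dist p s n y"
proof -
  have "(\<Sum>i=1..n. \<Sum>j=1..n. lp_norm p (x i - x j) powr s)
      = (\<Sum>i=1..n. \<Sum>j=1..n. lp_norm p (y i - y j) powr s)"
    by (intro sum.cong refl) (simp add: assms)
  then show ?thesis by (simp only: avg_dist_def)
qed

text \<open>If all edges were shorter than the claimed bound, the upper bound for the mean distance
  in \<open>lp_space q\<close> would fall below the lower bound for the mean distance in
  \<open>lp_space p\<close>, although the two means agree.\<close>

lemma cube_distortion:
  fixes f :: "nat set \<Rightarrow> nat \<Rightarrow> real" and p q r s :: real
  assumes p: "1 \<le> p" "p < 2" "p < q" and r: "1 \<le> r" and s: "1 \<le> s" and A: "finite A" "A \<noteq> {}"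
    and f: "\<And>S. S \<subseteq> A \<Longrightarrow> f S \<in> lp_space q"
    and eq: "cube_avg A (\<lambda>T. cube_avg A (\<lambda>S. lp_norm q (f S - f T) powr r)) powr (1 / r)
      = cube_avg A (\<lambda>T. cube_avg A (\<lambda>S. lp_norm p (indicator S - indicator T) powr s)) powr (1 / s)"
  shows "\<exists>S T. S \<subseteq> A \<and> T \<subseteq> A \<and> card (sym_diff S T) = 1 \<and>
    card A powr (1 / p - 1 / min q 2) / (1080 * sqrt (q + r)) \<le> lp_norm q (f S - f T)"
proof (rule ccontr)
  assume contra: "\<not> ?thesis"
  let ?D = "card A powr (1 / min q 2)"
  \<comment> \<open>Chosen so that \<open>270 * sqrt (q + r) * ?D * K\<close> is exactly the lower
    bound \<open>card A powr (1 / p) / 4\<close>; hence \<open>1080 = 4 * 270\<close>.\<close>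
  define K where "K = card A powr (1 / p - 1 / min q 2) / (1080 * sqrt (q + r))"
  define I where "I = {(S, k). S \<subseteq> A \<and> k \<in> A}"
  define L where "L = Max ((\<lambda>(S, k). lp_norm q (f (insert k S) - f (S - {k}))) ` I)"
  have "I = Pow A \<times> A" by (auto simp: I_def)
  then have I: "finite I" "I \<noteq> {}" using A by auto
  have lt: "lp_norm q (f (insert k S) - f (S - {k})) < K" if "S \<subseteq> A" "k \<in> A" for S k
  proof -
    have "sym_diff (insert k S) (S - {k}) = {k}" by auto
    then have "card (sym_diff (insert k S) (S - {k})) = 1" by simp
    moreover have "insert k S \<subseteq> A" "S - {k} \<subseteq> A" using that by auto
    ultimately show ?thesis using contra unfolding K_def by (meson not_le)
  qed
  \<comment> \<open>There are finitely many edges, so the largest image length is attained and the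
    inequality stays strict.\<close>
  then have "L < K" unfolding L_def using I by (subst Max_less_iff) (auto simp: I_def)
  have lip: "lp_norm q (f (insert k S) - f (S - {k})) \<le> L" if "S \<subseteq> A" "k \<in> A" for S k
    unfolding L_def using I that by (intro Max_ge) (auto simp: I_def image_iff)
  obtain S0 k0 where "(S0, k0) \<in> I" using I by auto
  then have L: "L \<ge> 0"
    using lip[of S0 k0] lp_norm_nonneg[of q "f (insert k0 S0) - f (S0 - {k0})"] by (auto simp: I_def)
  have d: "real (card A) > 0" using A by (simp add: card_gt_0_iff)
  have "card A powr (1 / p) / 4
      \<le> cube_avg A (\<lambda>T. cube_avg A (\<lambda>S. (card (sym_diff S T) powr (1 / p)) powr s)) powr (1 / s)"
    using A p s by (intro cube_hamming_moment) auto
  also have "\<dots> = cube_avg A (\<lambda>T. cube_avg A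
      (\<lambda>S. lp_norm p (indicator S - indicator T) powr s)) powr (1 / s)"
  proof -
    have "cube_avg A (\<lambda>T. cube_avg A (\<lambda>S. (card (sym_diff S T) powr (1 / p)) powr s))
        = cube_avg A (\<lambda>T. cube_avg A (\<lambda>S. lp_norm p (indicator S - indicator T) powr s))"
      using A by (intro cube_avg_cong) (simp add: lp_norm_indicator_diff finite_subset)
    then show ?thesis by simp
  qed
  also have "\<dots> = cube_avg A (\<lambda>T. cube_avg A (\<lambda>S. lp_norm q (f S - f T) powr r)) powr (1 / r)"
    by (simp only: eq)
  also have "\<dots> \<le> 270 * sqrt (q + r) * ?D * L"
    using A p r f lip L by (intro cube_lp_moment_distance) auto
  also have "\<dots> < 270 * sqrt (q + r) * ?D * K"
    using \<open>L < K\<close> d p r by (intro mult_strict_left_mono) auto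
  also have "\<dots> = card A powr (1 / p) / 4"
  proof -
    have "?D * card A powr (1 / p - 1 / min q 2) = card A powr (1 / p)"
      by (simp flip: powr_add)
    moreover have "sqrt (q + r) > 0" using p r by simp
    ultimately show ?thesis by (simp add: K_def field_simps)
  qed
  finally show False by simp
qed

theorem lemma1p12:
  shows "\<exists>c::real. c > 0 \<and>
    (\<forall>p q r s :: real.
       1 \<le> p \<and> 1 \<le> q \<and> 1 \<le> r \<and> 1 \<le> s \<and> p < 2 \<and> p < q \<longrightarrow>
       (\<forall>N::nat. \<exists>n\<ge>N. \<exists>x :: nat \<Rightarrow> nat \<Rightarrow> real.
          (\<forall>i\<in>{1..n}. x i \<in> lp_space p) \<and>
          (\<forall>y :: nat \<Rightarrow> nat \<Rightarrow> real.
             (\<forall>i\<in>{1..n}. y i \<in> lp_space q) \<and> avg_dist q r n y = avg_dist p s n x \<longrightarrow>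
             (\<exists>i\<in>{1..n}. \<exists>j\<in>{1..n}.
                lp_norm q (y i - y j) \<ge>
                  c * (ln (real n) powr (1 / p - 1 / min q 2) / sqrt (q + r)) *
                    lp_norm p (x i - x j) \<and>
                c * (ln (real n) powr (1 / p - 1 / min q 2) / sqrt (q + r)) *
                    lp_norm p (x i - x j) > 0))))"
proof (intro exI[of _ "1 / 1080"] conjI allI impI)
  fix p q r s :: real and N :: nat
  assume "1 \<le> p \<and> 1 \<le> q \<and> 1 \<le> r \<and> 1 \<le> s \<and> p < 2 \<and> p < q"
  then have p: "1 \<le> p" "p < 2" "p < q" and r: "1 \<le> r" and s: "1 \<le> s" by auto
  \<comment> \<open>Dimension \<open>Suc N\<close> keeps the cube nontrivial even for
    \<open>N = 0\<close>, so that \<open>ln n > 0\<close>.\<close>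
  define A where "A = {..<Suc N}"
  have A: "finite A" "A \<noteq> {}" "card A = Suc N" by (auto simp: A_def)
  define n :: nat where "n = 2 ^ card A"
  define \<theta> where "\<theta> = 1 / p - 1 / min q 2"
  have "1 / min q 2 \<le> 1 / p" using p by (intro divide_left_mono) auto
  \<comment> \<open>A nonnegative exponent allows the dimension to be replaced by the smaller
    \<open>ln n = card A * ln 2\<close>.\<close>
  then have \<theta>: "\<theta> \<ge> 0" by (simp add: \<theta>_def)
  have "N \<le> n" using less_exp[of "Suc N"] by (simp only: n_def A)
  have ln_n: "0 < ln (real n)" "ln (real n) \<le> card A"
  proof -
    have "ln (real n) = card A * ln 2" by (simp add: n_def ln_realpow)
    moreover have "ln (2 :: real) \<le> 1" using ln_le_minus_one[of 2] by simp
    ultimately show "0 < ln (real n)" "ln (real n) \<le> card A"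
      using A by (auto simp: mult_left_le)
  qed
  obtain e where e: "bij_betw e {1..n} (Pow A)"
  proof -
    have "card {1..n} = card (Pow A)" using A by (simp add: n_def card_Pow)
    then show ?thesis using that finite_same_card_bij[of "{1..n}" "Pow A"] A by auto
  qed
  define e' where "e' = inv_into {1..n} e"
  have e'_in: "e' S \<in> {1..n}" and e_e': "e (e' S) = S" if "S \<subseteq> A" for S
  proof -
    have "S \<in> e ` {1..n}" using e that by (simp add: bij_betw_def)
    then show "e' S \<in> {1..n}" "e (e' S) = S"
      unfolding e'_def by (rule inv_into_into, rule f_inv_into_f)
  qed
  have e'_e: "e' (e i) = i" if "i \<in> {1..n}" for i
    using e that by (simp add: e'_def bij_betw_def)
  have e_sub: "e i \<subseteq> A" if "i \<in> {1..n}" for i using e that by (auto simp: bij_betw_def)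
  define x :: "nat \<Rightarrow> nat \<Rightarrow> real" where "x i = indicator (e i)" for i
  show "\<exists>n\<ge>N. \<exists>x :: nat \<Rightarrow> nat \<Rightarrow> real.
          (\<forall>i\<in>{1..n}. x i \<in> lp_space p) \<and>
          (\<forall>y :: nat \<Rightarrow> nat \<Rightarrow> real.
             (\<forall>i\<in>{1..n}. y i \<in> lp_space q) \<and> avg_dist q r n y = avg_dist p s n x \<longrightarrow>
             (\<exists>i\<in>{1..n}. \<exists>j\<in>{1..n}.
                lp_norm q (y i - y j) \<ge>
                  1 / 1080 * (ln (real n) powr (1 / p - 1 / min q 2) / sqrt (q + r)) *
                    lp_norm p (x i - x j) \<and>
                1 / 1080 * (ln (real n) powr (1 / p - 1 / min q 2) / sqrt (q + r)) *
                    lp_norm p (x i - x j) > 0))"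
  proof (intro exI[of _ n] exI[of _ x] conjI ballI allI impI)
    show "N \<le> n" by fact
    show "x i \<in> lp_space p" if "i \<in> {1..n}" for i
      unfolding x_def using e_sub[OF that] A by (intro indicator_in_lp_space) (rule finite_subset)
  next
    fix y :: "nat \<Rightarrow> nat \<Rightarrow> real"
    assume "(\<forall>i\<in>{1..n}. y i \<in> lp_space q) \<and> avg_dist q r n y = avg_dist p s n x"
    then have y: "\<And>i. i \<in> {1..n} \<Longrightarrow> y i \<in> lp_space q" and "avg_dist q r n y = avg_dist p s n x"
      by auto
    \<comment> \<open>Only the indices \<open>1..n\<close> enter \<open>avg_dist\<close>, and there
      \<open>e'\<close> inverts \<open>e\<close>; thus \<open>y\<close> becomes a function on the
      vertices.\<close>
    moreover have "avg_dist q r n y = avg_dist q r n (\<lambda>i. y (e' (e i)))"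
      by (intro avg_dist_cong) (simp add: e'_e)
    ultimately have
      "cube_avg A (\<lambda>T. cube_avg A (\<lambda>S. lp_norm q (y (e' S) - y (e' T)) powr r)) powr (1 / r)
      = cube_avg A (\<lambda>T. cube_avg A (\<lambda>S. lp_norm p (indicator S - indicator T) powr s)) powr (1 / s)"
      using avg_dist_eq_cube_avg[OF e[unfolded n_def], of q r "\<lambda>S. y (e' S)"]
        avg_dist_eq_cube_avg[OF e[unfolded n_def], of p s indicator]
      unfolding n_def x_def by simp
    then obtain S T where ST: "S \<subseteq> A" "T \<subseteq> A" "card (sym_diff S T) = 1"
      and le: "card A powr \<theta> / (1080 * sqrt (q + r)) \<le> lp_norm q (y (e' S) - y (e' T))"
      using cube_distortion[OF p r s A(1,2), of "\<lambda>S. y (e' S)"] y[OF e'_in] unfolding \<theta>_def by blast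
    \<comment> \<open>The pair found is an edge, so its length in \<open>lp_space p\<close> drops
      out of the bound and positivity is immediate.\<close>
    have "lp_norm p (x (e' S) - x (e' T)) = 1"
      unfolding x_def using ST A
      by (simp add: e_e' lp_norm_indicator_diff finite_subset)
    moreover have "1 / 1080 * (ln (real n) powr \<theta> / sqrt (q + r)) \<le> card A powr \<theta> / (1080 * sqrt (q + r))"
      using ln_n \<theta> p r by (simp add: divide_right_mono powr_mono2)
    moreover have "0 < 1 / 1080 * (ln (real n) powr \<theta> / sqrt (q + r))"
      using ln_n p r by simp
    ultimately show "\<exists>i\<in>{1..n}. \<exists>j\<in>{1..n}.
                lp_norm q (y i - y j) \<ge>
                  1 / 1080 * (ln (real n) powr (1 / p - 1 / min q 2) / sqrt (q + r)) *
                    lp_norm p (x i - x j) \<and>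
                1 / 1080 * (ln (real n) powr (1 / p - 1 / min q 2) / sqrt (q + r)) *
                    lp_norm p (x i - x j) > 0"
      using ST le e'_in unfolding \<theta>_def[symmetric]
      by (intro bexI[of _ "e' S"] bexI[of _ "e' T"]) auto
  qed
qed simp

end
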